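(* Let $m_1,m_2,n\in\mathbb{N}$ with $m_2\ge m_1$, $m=m_1+m_2$, $j=\begin{bmatrix} I_{m_1}&0\\0&-I_{m_2}\end{bmatrix}$, let $c,d\in\mathbb{R}$, let $\alpha$ be an $m_1\times m_2$ matrix with $\alpha\alpha^*=I_{m_1}$, and set $$\beta(x)=\begin{bmatrix} \mathrm{e}^{\mathrm{i}cx}I_{m_1} & \mathrm{e}^{-\mathrm{i}cx}\alpha\end{bmatrix},\qquad H(x)=dj+\beta(x)^*\beta(x).$$ Let $\mathcal{A}$ be an invertible $n\times n$ matrix, let $Q$ be an $n\times n$ matrix such that $$\mathcal{A}Q=Q\mathcal{A},\qquad Q^2=c(2\mathcal{A}+cI_n),$$ and let $f_1,f_2$ be $n\times m_1$ matrices. Then the $n\times m$ matrix function $\Lambda(x)=\begin{bmatrix}\Phi_1(x)&\Phi_2(x)\end{bmatrix}$, where $$\Phi_1(x)=\exp\{\mathrm{i}x(cI_n-d\mathcal{A})\}\big(\mathrm{e}^{\mathrm{i}xQ}f_1+\mathrm{e}^{-\mathrm{i}xQ}f_2\big),$$ $$\Phi_2(x)=\exp\{-\mathrm{i}x(cI_n+d\mathcal{A})\}\big(\mathrm{e}^{\mathrm{i}xQ}(\mathcal{A}+cI_n+Q)\mathcal{A}^{-1}f_1+\mathrm{e}^{-\mathrm{i}xQ}(\mathcal{A}+cI_n-Q)\mathcal{A}^{-1}f_2\big)\alpha,$$ satisfies $$\Lambda'(x)=-\mathrm{i}\mathcal{A}\Lambda(x)jH(x).$$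
   Context: All matrices have complex entries; $^*$ denotes the conjugate transpose, $'$ denotes $d/dx$, and $x$ is a real variable ($x\ge0$). *)

theory Defs
  imports "HOL-Analysis.Analysis"
begin

(* Dimensions are finite index types: an m1 x m2 matrix is complex ^ 'm2 ^ 'm1, and the index set
   of size m = m1 + m2 is the disjoint sum 'm1 + 'm2, which makes the block structure explicit.
   The type class operations times, 1 and power on vectors are componentwise, so products, identities
   and powers of matrices are the library matrix product, mat 1 and mat_power below. *)

definition mat_cscale :: "complex \<Rightarrow> complex ^ 'k ^ 'l \<Rightarrow> complex ^ 'k ^ 'l"  (infixr "*\<^sub>C" 75)
  where "z *\<^sub>C A = (\<chi> i k. z * A $ i $ k)"

definition conj_transpose :: "complex ^ 'k ^ 'l \<Rightarrow> complex ^ 'l ^ 'k"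
  where "conj_transpose A = (\<chi> i k. cnj (A $ k $ i))"

primrec mat_power :: "complex ^ 'n ^ 'n \<Rightarrow> nat \<Rightarrow> complex ^ 'n ^ 'n" where
  "mat_power A 0 = mat 1"
| "mat_power A (Suc k) = A ** mat_power A k"

definition mat_exp :: "complex ^ 'n ^ 'n \<Rightarrow> complex ^ 'n ^ 'n"
  where "mat_exp A = (\<Sum>k. mat_power A k /\<^sub>R fact k)"

definition hblock :: "complex ^ 'k ^ 'r \<Rightarrow> complex ^ 'l ^ 'r \<Rightarrow> complex ^ ('k + 'l) ^ 'r"
  where "hblock A B = (\<chi> i s. case s of Inl k \<Rightarrow> A $ i $ k | Inr l \<Rightarrow> B $ i $ l)"

definition vblock :: "complex ^ 'r ^ 'k \<Rightarrow> complex ^ 'r ^ 'l \<Rightarrow> complex ^ 'r ^ ('k + 'l)"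
  where "vblock A B = (\<chi> s. case s of Inl k \<Rightarrow> A $ k | Inr l \<Rightarrow> B $ l)"

definition j_mat :: "complex ^ ('m1::finite + 'm2::finite) ^ ('m1 + 'm2)"
  where "j_mat = vblock (hblock (mat 1) 0) (hblock 0 (- mat 1))"

definition beta :: "real \<Rightarrow> complex ^ 'm2 ^ 'm1 \<Rightarrow> real \<Rightarrow> complex ^ ('m1 + 'm2) ^ 'm1"
  where "beta c \<alpha> x = hblock (exp (\<i> * c * x) *\<^sub>C mat 1) (exp (- \<i> * c * x) *\<^sub>C \<alpha>)"

definition Ham :: "real \<Rightarrow> real \<Rightarrow> complex ^ 'm2 ^ 'm1 \<Rightarrow> real
    \<Rightarrow> complex ^ ('m1 + 'm2) ^ ('m1 + 'm2)"
  where "Ham c d \<alpha> x = d *\<^sub>R j_mat + conj_transpose (beta c \<alpha> x) ** beta c \<alpha> x"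

definition Phi1 :: "real \<Rightarrow> real \<Rightarrow> complex ^ 'n ^ 'n \<Rightarrow> complex ^ 'n ^ 'n
    \<Rightarrow> complex ^ 'm1 ^ 'n \<Rightarrow> complex ^ 'm1 ^ 'n \<Rightarrow> real \<Rightarrow> complex ^ 'm1 ^ 'n"
  where "Phi1 c d A Q f1 f2 x =
    mat_exp ((\<i> * x) *\<^sub>C (c *\<^sub>R mat 1 - d *\<^sub>R A)) **
      (mat_exp ((\<i> * x) *\<^sub>C Q) ** f1 + mat_exp ((- \<i> * x) *\<^sub>C Q) ** f2)"

definition Phi2 :: "real \<Rightarrow> real \<Rightarrow> complex ^ 'm2 ^ 'm1 \<Rightarrow> complex ^ 'n ^ 'n \<Rightarrow> complex ^ 'n ^ 'n
    \<Rightarrow> complex ^ 'm1 ^ 'n \<Rightarrow> complex ^ 'm1 ^ 'n \<Rightarrow> real \<Rightarrow> complex ^ 'm2 ^ 'n"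
  where "Phi2 c d \<alpha> A Q f1 f2 x =
    mat_exp ((- \<i> * x) *\<^sub>C (c *\<^sub>R mat 1 + d *\<^sub>R A)) **
      (mat_exp ((\<i> * x) *\<^sub>C Q) ** (A + c *\<^sub>R mat 1 + Q) ** matrix_inv A ** f1 +
       mat_exp ((- \<i> * x) *\<^sub>C Q) ** (A + c *\<^sub>R mat 1 - Q) ** matrix_inv A ** f2) ** \<alpha>"

definition Lam :: "real \<Rightarrow> real \<Rightarrow> complex ^ 'm2 ^ 'm1 \<Rightarrow> complex ^ 'n ^ 'n \<Rightarrow> complex ^ 'n ^ 'n
    \<Rightarrow> complex ^ 'm1 ^ 'n \<Rightarrow> complex ^ 'm1 ^ 'n \<Rightarrow> real \<Rightarrow> complex ^ ('m1 + 'm2) ^ 'n"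
  where "Lam c d \<alpha> A Q f1 f2 x = hblock (Phi1 c d A Q f1 f2 x) (Phi2 c d \<alpha> A Q f1 f2 x)"

end

theory Submission
  imports Defs
begin

text \<open>
  The scalar matrices in the exponents split off as scalar factors, so that
  \<open>\<Lambda> = [e\<^sup>i\<^sup>c\<^sup>x p, e\<^sup>-\<^sup>i\<^sup>c\<^sup>x q \<alpha>]\<close> with \<open>p = U f\<^sub>1 + V f\<^sub>2\<close> and \<open>q = U g\<^sub>1 + V g\<^sub>2\<close>.  Here
  \<open>U(x) = exp(- i d x A) exp(i x Q)\<close>, \<open>V\<close> is the same function with \<open>- Q\<close> in place of \<open>Q\<close>,
  \<open>g\<^sub>1 = (A + c + Q) A\<^sup>-\<^sup>1 f\<^sub>1\<close> and \<open>g\<^sub>2 = (A + c - Q) A\<^sup>-\<^sup>1 f\<^sub>2\<close>.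

  On the other side, \<open>j\<^sup>2 = 1\<close> and \<open>\<alpha> \<alpha>\<^sup>* = 1\<close> turn the product with \<open>j H\<close> into an expression in
  \<open>p\<close>, \<open>q\<close> and the scalar phases, whose second block has \<open>\<alpha>\<close> as a right factor, as that of
  \<open>\<Lambda>\<close> has (\<open>hblock_j_Ham\<close>).  After the phases cancel, the claim is the system with constant coefficients
  \<open>p' = i (A q - (1 + d) A p - c p)\<close>, \<open>q' = i ((1 - d) A q - A p + c q)\<close>.

  This system is linear, and the hypotheses on \<open>Q\<close> also hold for \<open>- Q\<close>, so it suffices to treat
  \<open>p = U f\<close> and \<open>q = U g\<close> with \<open>g = (A + c + Q) A\<^sup>-\<^sup>1 f\<close> (\<open>mode_system\<close>).  As \<open>A\<close> and \<open>Q\<close> commute,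
  \<open>U' = - i d A U + i U Q\<close>, and the system reduces to two linear relations without \<open>x\<close>:
  \<open>Q f = A g - A f - c f\<close>, which is \<open>A\<close> times the definition of \<open>g\<close>, and \<open>Q g = A g - A f + c g\<close>, which is the
  same as \<open>Q\<^sup>2 = c (2 A + c)\<close> applied to \<open>A\<^sup>-\<^sup>1 f\<close>.

  Three properties of the matrix exponential suffice: it commutes with whatever commutes with the
  exponent, \<open>exp (x M)\<close> has derivative \<open>M exp (x M)\<close>, and scalar summands of the exponent split off.
  The addition theorem for general commuting exponents is avoided, since the product of two
  exponentials is differentiated by the product rule.
\<close>

section \<open>Matrix algebra with complex scalars\<close>

lemma bounded_bilinear_matrix_mult:
  "bounded_bilinear ((**) :: complex ^ 'k ^ 'l \<Rightarrow> complex ^ 'r ^ 'k \<Rightarrow> complex ^ 'r ^ 'l)"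
  unfolding bilinear_conv_bounded_bilinear[symmetric] bilinear_def linear_iff
  by (simp add: vec_eq_iff matrix_matrix_mult_def algebra_simps sum.distrib scaleR_sum_right)

interpretation matmul: bounded_bilinear
  "(**) :: complex ^ 'k ^ 'l \<Rightarrow> complex ^ 'r ^ 'k \<Rightarrow> complex ^ 'r ^ 'l"
  by (rule bounded_bilinear_matrix_mult)

lemma bounded_bilinear_mat_cscale:
  "bounded_bilinear ((*\<^sub>C) :: complex \<Rightarrow> complex ^ 'k ^ 'l \<Rightarrow> complex ^ 'k ^ 'l)"
  unfolding bilinear_conv_bounded_bilinear[symmetric] bilinear_def linear_iff
  by (simp add: vec_eq_iff mat_cscale_def algebra_simps)

lemma cscale_matmul_left: "(z *\<^sub>C A) ** B = z *\<^sub>C (A ** B)"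
  by (simp add: vec_eq_iff matrix_matrix_mult_def mat_cscale_def sum_distrib_left mult_ac)

lemma cscale_matmul_right: "A ** (z *\<^sub>C B) = z *\<^sub>C (A ** B)"
  by (simp add: vec_eq_iff matrix_matrix_mult_def mat_cscale_def sum_distrib_left mult_ac)

lemma cscale_simps:
  "z *\<^sub>C (A + B) = z *\<^sub>C A + z *\<^sub>C B"
  "z *\<^sub>C (A - B) = z *\<^sub>C A - z *\<^sub>C B"
  "z *\<^sub>C (- A) = - (z *\<^sub>C A)"
  "(- z) *\<^sub>C A = - (z *\<^sub>C A)"
  "z *\<^sub>C (w *\<^sub>C A) = (z * w) *\<^sub>C A"
  "z *\<^sub>C (r *\<^sub>R A) = (z * of_real r) *\<^sub>C A"
  "r *\<^sub>R (z *\<^sub>C A) = (of_real r * z) *\<^sub>C A"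
  "1 *\<^sub>C A = A"
  "0 *\<^sub>C A = 0"
  by (simp_all add: vec_eq_iff mat_cscale_def algebra_simps scaleR_conv_of_real[where 'a=complex])

lemma has_vector_derivative_matrix_componentwise:
  fixes F :: "real \<Rightarrow> complex ^ 'k ^ 'l"
  assumes "\<And>i k. ((\<lambda>x. F x $ i $ k) has_vector_derivative D $ i $ k) (at x within S)"
  shows "(F has_vector_derivative D) (at x within S)"
  unfolding has_vector_derivative_def
proof (subst has_derivative_componentwise_within, intro ballI)
  fix b :: "complex ^ 'k ^ 'l"
  assume "b \<in> Basis"
  then obtain i k z where b: "b = axis i (axis k z)"
    by (auto simp: Basis_vec_def)
  have "((\<lambda>x. F x $ i $ k \<bullet> z) has_derivative (\<lambda>h. (h *\<^sub>R D $ i $ k) \<bullet> z)) (at x within S)"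
    using assms[of i k] unfolding has_vector_derivative_def
    by (rule has_derivative_inner_left)
  then show "((\<lambda>x. F x \<bullet> b) has_derivative (\<lambda>h. (h *\<^sub>R D) \<bullet> b)) (at x within S)"
    by (simp add: b inner_axis)
qed

section \<open>The matrix exponential\<close>

lemma mat_power_scaleR: "mat_power (x *\<^sub>R M) n = x ^ n *\<^sub>R mat_power M n"
  by (induction n) (simp_all add: matmul.scaleR_left matmul.scaleR_right)

lemma mat_power_commute:
  assumes "B ** M = M ** B"
  shows "B ** mat_power M n = mat_power M n ** B"
proof (induction n)
  case (Suc n)
  then show ?case
    by (metis assms mat_power.simps(2) matrix_mul_assoc)
qed simp

text \<open>
  The matrix product is submultiplicative up to a constant \<open>K\<close> only, so the terms are compared
  with those of \<open>exp (K \<parallel>M\<parallel>)\<close>.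
\<close>

lemma summable_mat_exp:
  fixes M :: "complex ^ 'n ^ 'n"
  shows "summable (\<lambda>k. mat_power M k /\<^sub>R fact k)"
proof -
  obtain K where K: "K > 0"
    "\<And>(X :: complex ^ 'n ^ 'n) (Y :: complex ^ 'n ^ 'n). norm (X ** Y) \<le> norm X * norm Y * K"
    using matmul.pos_bounded by blast
  define N where "N = norm (mat 1 :: complex ^ 'n ^ 'n)"
  have bound: "norm (mat_power M k) \<le> N * (norm M * K) ^ k" for k
  proof (induction k)
    case (Suc k)
    have "norm (mat_power M (Suc k)) \<le> norm M * norm (mat_power M k) * K"
      using K(2) by simp
    also have "\<dots> \<le> norm M * (N * (norm M * K) ^ k) * K"
      using Suc K(1) by (intro mult_right_mono mult_left_mono) auto
    finally show ?case by (simp add: mult_ac)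
  qed (simp add: N_def)
  show ?thesis
  proof (rule summable_comparison_test)
    show "summable (\<lambda>k. N * ((norm M * K) ^ k /\<^sub>R fact k))"
      by (intro summable_mult summable_exp_generic)
    show "\<exists>N'. \<forall>n\<ge>N'. norm (mat_power M n /\<^sub>R fact n) \<le> N * ((norm M * K) ^ n /\<^sub>R fact n)"
      using bound by (auto simp: field_simps)
  qed
qed

lemma mat_exp_sums: "(\<lambda>k. mat_power M k /\<^sub>R fact k) sums mat_exp M"
  unfolding mat_exp_def by (rule summable_sums[OF summable_mat_exp])

lemma mat_exp_commute:
  assumes "B ** M = M ** B"
  shows "B ** mat_exp M = mat_exp M ** B"
proof (rule sums_unique2)
  show "(\<lambda>k. B ** (mat_power M k /\<^sub>R fact k)) sums (B ** mat_exp M)"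
    by (rule bounded_linear.sums[OF matmul.bounded_linear_right mat_exp_sums])
  have "(\<lambda>k. (mat_power M k /\<^sub>R fact k) ** B) sums (mat_exp M ** B)"
    by (rule bounded_linear.sums[OF matmul.bounded_linear_left mat_exp_sums])
  then show "(\<lambda>k. B ** (mat_power M k /\<^sub>R fact k)) sums (mat_exp M ** B)"
    by (simp add: matmul.scaleR_left matmul.scaleR_right mat_power_commute[OF assms])
qed

lemma mat_exp_zero [simp]: "mat_exp 0 = mat 1"
proof (rule sums_unique2[OF mat_exp_sums])
  have "mat_power (0 :: complex ^ 'a ^ 'a) k /\<^sub>R fact k = (if k = 0 then mat 1 else 0)" for k
    by (cases k) (auto simp: matmul.zero_left)
  then show "(\<lambda>k. mat_power (0 :: complex ^ 'a ^ 'a) k /\<^sub>R fact k) sums mat 1"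
    using sums_single[of 0 "\<lambda>_. mat 1 :: complex ^ 'a ^ 'a"] by (simp add: eq_commute)
qed

text \<open>
  Each entry of \<open>mat_exp (x *\<^sub>R M)\<close> is an everywhere convergent scalar power series in \<open>x\<close>, which may
  be differentiated term by term.
\<close>

lemma mat_exp_has_vector_derivative:
  "((\<lambda>x. mat_exp (x *\<^sub>R M)) has_vector_derivative M ** mat_exp (x *\<^sub>R M)) (at x within S)"
proof (rule has_vector_derivative_matrix_componentwise)
  fix i k
  define c where "c n = mat_power M n $ i $ k / fact n" for n
  have entry: "(\<lambda>n. c n * of_real y ^ n) sums (mat_exp (y *\<^sub>R M) $ i $ k)" for y :: real
  proof -
    have "(\<lambda>n. (mat_power (y *\<^sub>R M) n /\<^sub>R fact n) $ i $ k) sums (mat_exp (y *\<^sub>R M) $ i $ k)"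
      by (intro sums_vec_nth mat_exp_sums)
    then show ?thesis
      by (simp add: c_def mat_power_scaleR scaleR_conv_of_real[where 'a=complex] field_simps)
  qed
  \<comment> \<open>Convergence at the real point \<open>norm z + 1\<close> gives convergence at the smaller complex \<open>z\<close>.\<close>
  have summ: "summable (\<lambda>n. c n * z ^ n)" for z
    by (rule powser_inside[of _ "of_real (norm z + 1)"])
      (use sums_summable[OF entry[of "norm z + 1"]] in simp_all)
  have diffs_c: "diffs c n * of_real x ^ n = (M ** (mat_power (x *\<^sub>R M) n /\<^sub>R fact n)) $ i $ k" for n
  proof -
    have "diffs c n = (M ** mat_power M n) $ i $ k / fact n"
      unfolding diffs_def c_def by (simp add: fact_Suc del: of_nat_Suc)
    then show ?thesis
      by (simp add: mat_power_scaleR matmul.scaleR_right scaleR_conv_of_real[where 'a=complex]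
          field_simps)
  qed
  have "(\<lambda>n. diffs c n * of_real x ^ n) sums ((M ** mat_exp (x *\<^sub>R M)) $ i $ k)"
    unfolding diffs_c
    by (intro sums_vec_nth bounded_linear.sums[OF matmul.bounded_linear_right mat_exp_sums])
  then have "((\<lambda>z. \<Sum>n. c n * z ^ n) has_field_derivative (M ** mat_exp (x *\<^sub>R M)) $ i $ k)
      (at (of_real x))"
    using termdiffs_strong_converges_everywhere[OF summ, of "of_real x"] by (simp add: sums_iff)
  then have "((\<lambda>y. \<Sum>n. c n * of_real y ^ n) has_vector_derivative
      (M ** mat_exp (x *\<^sub>R M)) $ i $ k) (at x within S)"
    by (rule has_vector_derivative_real_field)
  then show "((\<lambda>y. mat_exp (y *\<^sub>R M) $ i $ k) has_vector_derivative
      (M ** mat_exp (x *\<^sub>R M)) $ i $ k) (at x within S)"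
    using entry by (simp add: sums_iff)
qed

lemma cexp_has_vector_derivative:
  fixes a :: complex
  shows "((\<lambda>x. exp (a * of_real x)) has_vector_derivative a * exp (a * of_real x)) (at x within S)"
proof (rule has_vector_derivative_real_field[of "\<lambda>z. exp (a * z)"])
  show "((\<lambda>z. exp (a * z)) has_field_derivative a * exp (a * of_real x)) (at (of_real x))"
    by (auto intro!: derivative_eq_intros)
qed

lemma cexp_cscale_has_vector_derivative:
  assumes "(F has_vector_derivative F') (at x within S)"
  shows "((\<lambda>x. exp (a * of_real x) *\<^sub>C F x) has_vector_derivative
    exp (a * of_real x) *\<^sub>C (a *\<^sub>C F x + F')) (at x within S)"
  using bounded_bilinear.has_vector_derivative[OF bounded_bilinear_mat_cscale
      cexp_has_vector_derivative assms, of a]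
  by (simp add: cscale_simps mult_ac add_ac)

text \<open>
  Uniqueness for a linear differential equation: the product of \<open>exp (- t (b + L))\<close> with
  \<open>e\<^sup>b\<^sup>t exp (t L)\<close> has derivative zero, hence is constantly the identity.  Applied with \<open>b = a\<close> and
  \<open>L = M\<close> this makes the right-hand side a right inverse of \<open>exp (- x (a + M))\<close>; applied with
  \<open>b = 0\<close> and \<open>L = - (a + M)\<close> it makes \<open>exp (x (a + M))\<close> a left inverse of the same matrix.
\<close>

lemma mat_exp_scalar_shift:
  fixes M :: "complex ^ 'n ^ 'n"
  shows "mat_exp (x *\<^sub>R (a *\<^sub>C mat 1 + M)) = exp (a * of_real x) *\<^sub>C mat_exp (x *\<^sub>R M)"
proof -
  let ?N = "a *\<^sub>C mat 1 + M"
  have inverse: "mat_exp (t *\<^sub>R (- (b *\<^sub>C mat 1 + L)))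
      ** (exp (b * of_real t) *\<^sub>C mat_exp (t *\<^sub>R L)) = mat 1"
    for b :: complex and L :: "complex ^ 'n ^ 'n" and t :: real
  proof -
    let ?K = "b *\<^sub>C mat 1 + L"
    let ?W = "\<lambda>t. mat_exp (t *\<^sub>R (- ?K)) ** (exp (b * of_real t) *\<^sub>C mat_exp (t *\<^sub>R L))"
    have "(?W has_vector_derivative 0) (at t within UNIV)" for t
    proof -
      have comm: "?K ** mat_exp (t *\<^sub>R (- ?K)) = mat_exp (t *\<^sub>R (- ?K)) ** ?K"
        by (rule mat_exp_commute)
          (simp only: matmul.scaleR_left matmul.scaleR_right matmul.minus_left matmul.minus_right)
      have "(?W has_vector_derivative
          mat_exp (t *\<^sub>R (- ?K))
            ** (exp (b * of_real t) *\<^sub>C (b *\<^sub>C mat_exp (t *\<^sub>R L) + L ** mat_exp (t *\<^sub>R L)))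
          + ((- ?K) ** mat_exp (t *\<^sub>R (- ?K))) ** (exp (b * of_real t) *\<^sub>C mat_exp (t *\<^sub>R L)))
          (at t within UNIV)"
        by (intro matmul.has_vector_derivative mat_exp_has_vector_derivative
            cexp_cscale_has_vector_derivative)
      also have "b *\<^sub>C mat_exp (t *\<^sub>R L) + L ** mat_exp (t *\<^sub>R L) = ?K ** mat_exp (t *\<^sub>R L)"
        by (simp add: matmul.add_left cscale_matmul_left)
      also have "(- ?K) ** mat_exp (t *\<^sub>R (- ?K)) = - (mat_exp (t *\<^sub>R (- ?K)) ** ?K)"
        by (simp only: matmul.minus_left comm)
      finally show ?thesis
        by (simp only: cscale_matmul_right matmul.minus_left matrix_mul_assoc
            cscale_simps(3) add.right_inverse)
    qed
    then obtain W where "\<And>t. ?W t = W"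
      using has_vector_derivative_zero_constant[of UNIV ?W] by auto
    then have "?W t = ?W 0"
      by metis
    then show ?thesis
      by (simp add: cscale_simps)
  qed
  have "mat_exp (x *\<^sub>R ?N) = mat_exp (x *\<^sub>R ?N) **
      (mat_exp (x *\<^sub>R (- ?N)) ** (exp (a * of_real x) *\<^sub>C mat_exp (x *\<^sub>R M)))"
    by (simp only: inverse matrix_mul_rid)
  also have "\<dots> = (mat_exp (x *\<^sub>R ?N) ** mat_exp (x *\<^sub>R (- ?N)))
      ** (exp (a * of_real x) *\<^sub>C mat_exp (x *\<^sub>R M))"
    by (rule matrix_mul_assoc)
  also have "mat_exp (x *\<^sub>R ?N) ** mat_exp (x *\<^sub>R (- ?N)) = mat 1"
    using inverse[of x 0 "- ?N"]
    by (simp only: cscale_simps minus_minus add_0 mult_zero_left exp_zero)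
  finally show ?thesis
    by simp
qed


section \<open>The exponential modes\<close>

text \<open>
  One of the two oscillating families in \<open>\<Lambda>\<close>, stripped of the scalar phase \<open>e\<^sup>\<plusminus>\<^sup>i\<^sup>c\<^sup>x\<close>; the other
  one has \<open>- Q\<close> for \<open>Q\<close>.
\<close>

definition mode :: "real \<Rightarrow> complex ^ 'n ^ 'n \<Rightarrow> complex ^ 'n ^ 'n \<Rightarrow> real \<Rightarrow> complex ^ 'n ^ 'n"
  where "mode d A Q x =
    mat_exp (x *\<^sub>R ((- (\<i> * of_real d)) *\<^sub>C A)) ** mat_exp (x *\<^sub>R (\<i> *\<^sub>C Q))"

lemma mode_commute:
  assumes "B ** A = A ** B" "B ** Q = Q ** B"
  shows "B ** mode d A Q x = mode d A Q x ** B"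
proof -
  let ?P = "mat_exp (x *\<^sub>R ((- (\<i> * of_real d)) *\<^sub>C A))" and ?E = "mat_exp (x *\<^sub>R (\<i> *\<^sub>C Q))"
  have "B ** ?P = ?P ** B" and "B ** ?E = ?E ** B"
    by (rule mat_exp_commute, simp add: assms matmul.scaleR_left matmul.scaleR_right
        cscale_matmul_left cscale_matmul_right)+
  then show ?thesis
    unfolding mode_def by (metis matrix_mul_assoc)
qed

lemma mode_has_vector_derivative:
  assumes AQ: "A ** Q = Q ** A"
  shows "(mode d A Q has_vector_derivative
    (- (\<i> * of_real d)) *\<^sub>C (A ** mode d A Q x) + \<i> *\<^sub>C (mode d A Q x ** Q)) (at x within S)"
proof -
  let ?P = "\<lambda>x. mat_exp (x *\<^sub>R ((- (\<i> * of_real d)) *\<^sub>C A))"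
  let ?E = "\<lambda>x. mat_exp (x *\<^sub>R (\<i> *\<^sub>C Q))"
  have E: "Q ** ?E x = ?E x ** Q"
    by (rule mat_exp_commute)
      (simp add: matmul.scaleR_left matmul.scaleR_right cscale_matmul_left cscale_matmul_right)
  have "((\<lambda>x. ?P x ** ?E x) has_vector_derivative
      ?P x ** ((\<i> *\<^sub>C Q) ** ?E x) + (((- (\<i> * of_real d)) *\<^sub>C A) ** ?P x) ** ?E x) (at x within S)"
    by (intro matmul.has_vector_derivative mat_exp_has_vector_derivative)
  also have "(\<i> *\<^sub>C Q) ** ?E x = \<i> *\<^sub>C (?E x ** Q)"
    by (simp only: cscale_matmul_left E)
  finally show ?thesis
    unfolding mode_def
    by (simp only: cscale_matmul_left cscale_matmul_right matrix_mul_assoc add.commute)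
qed

text \<open>
  A mode commutes with \<open>A\<close>, so that both equations can be read off after a
  common factor \<open>U\<close> on the left is removed; what remains are the relations \<open>Qf\<close> and \<open>Qg\<close> between
  the constant matrices.  They are checked in terms of \<open>h = A\<^sup>-\<^sup>1 f\<close>, where no inverse occurs.
\<close>

lemma mode_system:
  fixes c d :: real and A Q :: "complex ^ 'n ^ 'n" and f :: "complex ^ 'm ^ 'n"
  assumes inv: "invertible A"
    and AQ: "A ** Q = Q ** A"
    and QQ: "Q ** Q = c *\<^sub>R (2 *\<^sub>R A + c *\<^sub>R mat 1)"
  defines "g \<equiv> (A + c *\<^sub>R mat 1 + Q) ** matrix_inv A ** f"
  defines "p \<equiv> \<lambda>x. mode d A Q x ** f" and "q \<equiv> \<lambda>x. mode d A Q x ** g"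
  shows "(p has_vector_derivative
      \<i> *\<^sub>C (A ** q x - (1 + d) *\<^sub>R (A ** p x) - c *\<^sub>R p x)) (at x within S)"
    and "(q has_vector_derivative
      \<i> *\<^sub>C ((1 - d) *\<^sub>R (A ** q x) - A ** p x + c *\<^sub>R q x)) (at x within S)"
proof -
  let ?U = "mode d A Q x"
  define h where "h = matrix_inv A ** f"
  have "A ** matrix_inv A = mat 1"
    using someI_ex[OF inv[unfolded invertible_def]] by (simp add: matrix_inv_def)
  then have Ah: "A ** h = f"
    by (simp add: h_def matrix_mul_assoc)
  have g: "g = A ** h + c *\<^sub>R h + Q ** h"
    by (simp add: g_def h_def matmul.add_left matmul.scaleR_left flip: matrix_mul_assoc)
  have Qf: "Q ** f = A ** g - A ** f - c *\<^sub>R f"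
    by (simp add: g matmul.add_right matmul.scaleR_right Ah matrix_mul_assoc AQ)
       (simp flip: matrix_mul_assoc add: Ah)
  have "Q ** (Q ** h) = (2 * c) *\<^sub>R f + (c * c) *\<^sub>R h"
    by (simp add: matrix_mul_assoc QQ)
       (simp add: matmul.add_left matmul.scaleR_left scaleR_add_right Ah mult.commute)
  then have "Q ** g = Q ** f + c *\<^sub>R (Q ** h) + (2 * c) *\<^sub>R f + (c * c) *\<^sub>R h"
    by (simp add: g Ah matmul.add_right matmul.scaleR_right)
  also have "\<dots> = A ** g - A ** f + c *\<^sub>R g"
    by (simp add: Qf g Ah algebra_simps flip: scaleR_add_left)
       (simp add: scaleR_2 flip: scaleR_scaleR)
  finally have Qg: "Q ** g = A ** g - A ** f + c *\<^sub>R g" .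
  have AU: "A ** ?U = ?U ** A"
    by (rule mode_commute) (simp_all add: AQ)
  have deriv: "((\<lambda>x. mode d A Q x ** v) has_vector_derivative
      (- (\<i> * of_real d)) *\<^sub>C (A ** (?U ** v)) + \<i> *\<^sub>C (?U ** (Q ** v))) (at x within S)"
    for v :: "complex ^ 'm ^ 'n"
    using bounded_linear.has_vector_derivative[OF matmul.bounded_linear_left
        mode_has_vector_derivative[OF AQ]]
    by (simp add: matmul.add_left cscale_matmul_left matrix_mul_assoc)
  have A_past_U: "A ** (?U ** v) = ?U ** (A ** v)" for v :: "complex ^ 'm ^ 'n"
    by (simp add: matrix_mul_assoc AU)
  show "(p has_vector_derivative
      \<i> *\<^sub>C (A ** q x - (1 + d) *\<^sub>R (A ** p x) - c *\<^sub>R p x)) (at x within S)"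
    unfolding p_def q_def
    by (rule has_vector_derivative_eq_rhs[OF deriv])
       (simp add: A_past_U Qf matmul.add_right matmul.diff_right matmul.scaleR_right cscale_simps,
        simp add: vec_eq_iff mat_cscale_def algebra_simps)
  show "(q has_vector_derivative
      \<i> *\<^sub>C ((1 - d) *\<^sub>R (A ** q x) - A ** p x + c *\<^sub>R q x)) (at x within S)"
    unfolding p_def q_def
    by (rule has_vector_derivative_eq_rhs[OF deriv])
       (simp add: A_past_U Qg matmul.add_right matmul.diff_right matmul.scaleR_right cscale_simps,
        simp add: vec_eq_iff mat_cscale_def algebra_simps)
qed

section \<open>Block matrices\<close>

lemma sum_UNIV_Plus:
  "(\<Sum>s\<in>UNIV. h s) = (\<Sum>k\<in>UNIV. h (Inl k)) + (\<Sum>l\<in>UNIV. h (Inr l))"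
  for h :: "'k::finite + 'l::finite \<Rightarrow> 'b::comm_monoid_add"
  by (simp add: sum.Plus flip: UNIV_Plus_UNIV)

lemma matmul_hblock: "M ** hblock B C = hblock (M ** B) (M ** C)"
  by (auto simp: vec_eq_iff hblock_def matrix_matrix_mult_def split: sum.splits)

lemma hblock_matmul_vblock: "hblock X Y ** vblock B C = X ** B + Y ** C"
  by (simp add: vec_eq_iff hblock_def vblock_def matrix_matrix_mult_def sum_UNIV_Plus)

lemma conj_transpose_hblock:
  "conj_transpose (hblock B C) = vblock (conj_transpose B) (conj_transpose C)"
  by (auto simp: vec_eq_iff hblock_def vblock_def conj_transpose_def split: sum.splits)

lemma hblock_linear:
  "hblock A B + hblock C D = hblock (A + C) (B + D)"
  "r *\<^sub>R hblock A B = hblock (r *\<^sub>R A) (r *\<^sub>R B)"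
  "z *\<^sub>C hblock A B = hblock (z *\<^sub>C A) (z *\<^sub>C B)"
  by (auto simp: vec_eq_iff hblock_def mat_cscale_def split: sum.splits)

lemma hblock_matmul_j: "hblock X Y ** j_mat = hblock X (- Y)"
  by (simp add: j_mat_def hblock_matmul_vblock matmul_hblock hblock_linear
      matmul.zero_right matmul.minus_right)

lemma conj_transpose_cscale: "conj_transpose (z *\<^sub>C B) = cnj z *\<^sub>C conj_transpose B"
  by (simp add: vec_eq_iff conj_transpose_def mat_cscale_def)

lemma conj_transpose_one [simp]: "conj_transpose (mat 1) = mat 1"
  by (simp add: vec_eq_iff conj_transpose_def mat_def)

lemma has_vector_derivative_hblock:
  assumes "(F has_vector_derivative F') (at x within S)"
    and "(G has_vector_derivative G') (at x within S)"
  shows "((\<lambda>x. hblock (F x) (G x)) has_vector_derivative hblock F' G') (at x within S)"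
proof (rule has_vector_derivative_matrix_componentwise)
  have entry: "((\<lambda>x. H x $ i $ k) has_vector_derivative H' $ i $ k) (at x within S)"
    if "(H has_vector_derivative H') (at x within S)"
    for H :: "real \<Rightarrow> complex ^ 'k ^ 'l" and H' i k
    by (intro bounded_linear.has_vector_derivative[OF bounded_linear_vec_nth] that)
  fix i s
  show "((\<lambda>x. hblock (F x) (G x) $ i $ s) has_vector_derivative hblock F' G' $ i $ s) (at x within S)"
    by (cases s) (simp_all add: hblock_def entry[OF assms(1)] 
      bounded_linear.has_vector_derivative[OF bounded_linear_vec_nth] assms)
qed

text \<open>
  Since \<open>j\<^sup>2 = 1\<close>, the summand \<open>d j\<close> of the Hamiltonian contributes \<open>d\<close> times the row itself.  The other
  summand has rank \<open>m\<^sub>1\<close>: the row is first contracted with \<open>\<beta>\<^sup>*\<close>, where \<open>\<alpha> \<alpha>\<^sup>* = 1\<close>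
  removes \<open>\<alpha>\<close>, and then spread out again by \<open>\<beta>\<close>.  The two phases \<open>e\<^sup>\<plusminus>\<^sup>i\<^sup>c\<^sup>x\<close> cancel or add up.
\<close>

lemma hblock_j_Ham:
  fixes c d x :: real and \<alpha> :: "complex ^ 'm2 ^ 'm1"
  assumes "\<alpha> ** conj_transpose \<alpha> = mat 1"
  defines "e \<equiv> exp (\<i> * of_real c * of_real x)"
  shows "hblock X (Y ** \<alpha>) ** j_mat ** Ham c d \<alpha> x =
    hblock ((1 + d) *\<^sub>R X - (e * e) *\<^sub>C Y)
           (((d - 1) *\<^sub>R Y + inverse (e * e) *\<^sub>C X) ** \<alpha>)"
proof -
  have e': "exp (- \<i> * of_real c * of_real x) = inverse e" "cnj e = inverse e"
    by (simp_all add: e_def exp_minus exp_cnj)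
  have e0: "e \<noteq> 0" by (simp add: e_def)
  have Y: "Y ** \<alpha> ** conj_transpose \<alpha> = Y"
    by (simp add: assms(1) flip: matrix_mul_assoc)
  have "hblock X (- (Y ** \<alpha>)) ** conj_transpose (beta c \<alpha> x) = inverse e *\<^sub>C X - e *\<^sub>C Y"
    unfolding beta_def e'(1) 
    by (simp add: conj_transpose_hblock hblock_matmul_vblock conj_transpose_cscale e'
        cscale_matmul_right matmul.minus_left cscale_simps Y flip: e_def)
  then have "hblock X (- (Y ** \<alpha>)) ** (conj_transpose (beta c \<alpha> x) ** beta c \<alpha> x)
      = (inverse e *\<^sub>C X - e *\<^sub>C Y) ** beta c \<alpha> x"
    by (simp add: matrix_mul_assoc)
  also have "\<dots> = hblock (X - (e * e) *\<^sub>C Y) ((inverse (e * e) *\<^sub>C X - Y) ** \<alpha>)"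
    unfolding beta_def e'(1)
    by (simp add: matmul_hblock cscale_matmul_right matmul.diff_left cscale_matmul_left
        cscale_simps e0 flip: e_def)
  finally show ?thesis
    unfolding Ham_def hblock_matmul_j
    by (simp add: matmul.add_right matmul.scaleR_right hblock_matmul_j hblock_linear
        matmul.add_left matmul.diff_left matmul.scaleR_left algebra_simps)
qed

section \<open>The solution\<close>

theorem proposition4p1:
  fixes c d :: real
    and \<alpha> :: "complex ^ 'm2 ^ 'm1"
    and A Q :: "complex ^ 'n ^ 'n"
    and f1 f2 :: "complex ^ 'm1 ^ 'n"
  assumes "CARD('m2) \<ge> CARD('m1)"
    and "\<alpha> ** conj_transpose \<alpha> = mat 1"
    and "invertible A"
    and "A ** Q = Q ** A"
    and "Q ** Q = c *\<^sub>R (2 *\<^sub>R A + c *\<^sub>R mat 1)"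
  shows "\<forall>x\<ge>0. (Lam c d \<alpha> A Q f1 f2 has_vector_derivative
      (- \<i>) *\<^sub>C (A ** Lam c d \<alpha> A Q f1 f2 x ** j_mat ** Ham c d \<alpha> x)) (at x within {0..})"
proof (intro allI impI)
  fix x :: real
  let ?ic = "\<i> * of_real c"
  define g1 where "g1 = (A + c *\<^sub>R mat 1 + Q) ** matrix_inv A ** f1"
  define g2 where "g2 = (A + c *\<^sub>R mat 1 + - Q) ** matrix_inv A ** f2"
  define p where "p x = mode d A Q x ** f1 + mode d A (- Q) x ** f2" for x
  define q where "q x = mode d A Q x ** g1 + mode d A (- Q) x ** g2" for x

  have neg: "A ** (- Q) = (- Q) ** A" "(- Q) ** (- Q) = c *\<^sub>R (2 *\<^sub>R A + c *\<^sub>R mat 1)"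
    using assms(4,5) by (simp_all add: matmul.minus_left matmul.minus_right)
  have p': "(p has_vector_derivative
      \<i> *\<^sub>C (A ** q x - (1 + d) *\<^sub>R (A ** p x) - c *\<^sub>R p x)) (at x within {0..})"
    unfolding p_def q_def g1_def g2_def
    by (rule has_vector_derivative_eq_rhs[OF has_vector_derivative_add[OF
          mode_system(1)[OF assms(3-5)] mode_system(1)[OF assms(3) neg]]])
       (simp add: matmul.add_right scaleR_add_right cscale_simps algebra_simps)
  have q': "(q has_vector_derivative
      \<i> *\<^sub>C ((1 - d) *\<^sub>R (A ** q x) - A ** p x + c *\<^sub>R q x)) (at x within {0..})"
    unfolding p_def q_def g1_def g2_def
    by (rule has_vector_derivative_eq_rhs[OF has_vector_derivative_add[OF
          mode_system(2)[OF assms(3-5)] mode_system(2)[OF assms(3) neg]]])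
       (simp add: matmul.add_right scaleR_add_right cscale_simps algebra_simps)

  \<comment> \<open>The exponents as real multiples of fixed matrices, with the scalar part in front.\<close>
  have arg1: "(\<i> * of_real y) *\<^sub>C (c *\<^sub>R mat 1 - d *\<^sub>R A) =
      y *\<^sub>R (?ic *\<^sub>C mat 1 + (- (\<i> * of_real d)) *\<^sub>C A)"
    and arg2: "(- \<i> * of_real y) *\<^sub>C (c *\<^sub>R mat 1 + d *\<^sub>R A) =
      y *\<^sub>R ((- ?ic) *\<^sub>C mat 1 + (- (\<i> * of_real d)) *\<^sub>C A)"
    and arg3: "(\<i> * of_real y) *\<^sub>C Q = y *\<^sub>R (\<i> *\<^sub>C Q)"
    and arg4: "(- \<i> * of_real y) *\<^sub>C Q = y *\<^sub>R (\<i> *\<^sub>C (- Q))" for y :: real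
    by (simp_all add: vec_eq_iff mat_cscale_def scaleR_conv_of_real[where 'a=complex] algebra_simps)
  have Lam: "Lam c d \<alpha> A Q f1 f2 y =
      hblock (exp (?ic * of_real y) *\<^sub>C p y) ((exp (- ?ic * of_real y) *\<^sub>C q y) ** \<alpha>)" for y
    unfolding Lam_def Phi1_def Phi2_def arg1 arg2 arg3 arg4 mat_exp_scalar_shift
      p_def q_def g1_def g2_def mode_def
    by (simp add: matmul.add_right matmul.add_left cscale_matmul_left matrix_mul_assoc cscale_simps)

  define e where "e = exp (?ic * of_real x)"
  have e0: "e \<noteq> 0" and e': "exp (- ?ic * of_real x) = inverse e"
    by (simp_all add: e_def exp_minus)
  have ALam: "A ** Lam c d \<alpha> A Q f1 f2 x =
      hblock (e *\<^sub>C (A ** p x)) ((inverse e *\<^sub>C (A ** q x)) ** \<alpha>)"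
    unfolding Lam e' e_def[symmetric]
    by (simp add: matmul_hblock cscale_matmul_right cscale_matmul_left matrix_mul_assoc)
  have rhs: "(- \<i>) *\<^sub>C (A ** Lam c d \<alpha> A Q f1 f2 x ** j_mat ** Ham c d \<alpha> x) =
      hblock ((- \<i>) *\<^sub>C ((1 + d) *\<^sub>R (e *\<^sub>C (A ** p x)) - (e * e) *\<^sub>C (inverse e *\<^sub>C (A ** q x))))
        (((- \<i>) *\<^sub>C ((d - 1) *\<^sub>R (inverse e *\<^sub>C (A ** q x))
           + inverse (e * e) *\<^sub>C (e *\<^sub>C (A ** p x)))) ** \<alpha>)"
    by (simp only: ALam hblock_j_Ham[OF assms(2)] e_def[symmetric] hblock_linear)
       (simp only: cscale_matmul_left)
  have "((\<lambda>y. hblock (exp (?ic * of_real y) *\<^sub>C p y) ((exp (- ?ic * of_real y) *\<^sub>C q y) ** \<alpha>))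
      has_vector_derivative (- \<i>) *\<^sub>C (A ** Lam c d \<alpha> A Q f1 f2 x ** j_mat ** Ham c d \<alpha> x))
      (at x within {0..})"
    unfolding rhs
  proof (intro has_vector_derivative_hblock
      bounded_linear.has_vector_derivative[OF matmul.bounded_linear_left])
    show "((\<lambda>y. exp (?ic * of_real y) *\<^sub>C p y) has_vector_derivative
        (- \<i>) *\<^sub>C ((1 + d) *\<^sub>R (e *\<^sub>C (A ** p x)) - (e * e) *\<^sub>C (inverse e *\<^sub>C (A ** q x))))
        (at x within {0..})"
      using e0
      by (intro has_vector_derivative_eq_rhs[OF cexp_cscale_has_vector_derivative[OF p']])
         (simp only: e_def[symmetric],
          simp add: vec_eq_iff mat_cscale_def scaleR_conv_of_real[where 'a=complex] field_simps)
    show "((\<lambda>y. exp (- ?ic * of_real y) *\<^sub>C q y) has_vector_derivative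
        (- \<i>) *\<^sub>C ((d - 1) *\<^sub>R (inverse e *\<^sub>C (A ** q x))
           + inverse (e * e) *\<^sub>C (e *\<^sub>C (A ** p x)))) (at x within {0..})"
      using e0
      by (intro has_vector_derivative_eq_rhs[OF cexp_cscale_has_vector_derivative[OF q']])
         (simp only: e',
          simp add: vec_eq_iff mat_cscale_def scaleR_conv_of_real[where 'a=complex] field_simps)
  qed
  then show "(Lam c d \<alpha> A Q f1 f2 has_vector_derivative
      (- \<i>) *\<^sub>C (A ** Lam c d \<alpha> A Q f1 f2 x ** j_mat ** Ham c d \<alpha> x)) (at x within {0..})"
    by (simp only: Lam[abs_def])
qed

end
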